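(* Let $G$ be a simple connected graph with $n\ge 3$ vertices, Wiener index $W(G)$ and maximum transmission $Tr_{max}$. Then $$\frac{(n-1)(Tr_{max}+1)-2W(G)}{n-2}\leq DLS(G)\leq 2(n-1)Tr_{max}-2W(G).$$ Equality holds in the left inequality if and only if $G\cong K_n$.
   Context: All graphs are finite, simple and connected. For a connected graph $G$ on vertices $v_1,\dots,v_n$, $d_{uv}$ denotes the distance (length of a shortest path) between $u$ and $v$, and $D(G)=(d_{uv})$ is the distance matrix. The transmission of a vertex $v$ is $Tr(v)=\sum_{u\in V(G)}d_{uv}$, and $Tr_{max}=\max\{Tr(v):v\in V(G)\}$. The Wiener index is $W(G)=\frac12\sum_{u,v\in V(G)}d_{uv}=\frac12\sum_{v}Tr(v)$ (the sum of distances over unordered pairs of vertices). The distance Laplacian matrix is $D^L(G)=\mathrm{diag}(Tr(v_1),\dots,Tr(v_n))-D(G)$; it is positive semidefinite, and its eigenvalues, with multiplicity, are written $\partial_1^L(G)\ge \partial_2^L(G)\ge\dots\ge\partial_n^L(G)=0$. The distance Laplacian spread is $DLS(G)=\partial_1^L(G)-\partial_{n-1}^L(G)$. $K_n$ is the complete graph on $n$ vertices. *)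

theory Defs
  imports
    "Jordan_Normal_Form.Char_Poly"
    "Graph_Theory.Graph_Theory"
begin

text \<open>
  Graphs are those of the locale \<^locale>\<open>graph\<close>: finite symmetric digraphs without
  loops or multiple arcs, every edge being a pair of opposite arcs.
\<close>

definition graph_dist :: "('a, 'b) pre_digraph \<Rightarrow> 'a \<Rightarrow> 'a \<Rightarrow> real" where
  "graph_dist G u v = real_of_ereal (wf_digraph.\<mu> G (\<lambda>_. 1) u v)"

text \<open>
  The constant \<^const>\<open>wf_digraph.\<mu>\<close> is an infimum over walks in the extended reals.
  With unit weights it is the length of a shortest path between connected vertices.
\<close>

lemma (in fin_digraph) graph_dist_shortest_path:
  assumes "u \<rightarrow>\<^sup>* v"
  shows "\<exists>p. apath u p v \<and> graph_dist G u v = real (length p)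
           \<and> (\<forall>q. apath u q v \<longrightarrow> length p \<le> length q)"
proof -
  have cost: "awalk_cost (\<lambda>_. 1) q = real (length q)" for q
    by (induction q) auto
  obtain p where p: "apath u p v" "\<mu> (\<lambda>_. 1) u v = awalk_cost (\<lambda>_. 1) p"
    using min_cost_awalk[OF assms, of "\<lambda>_. 1"] by auto
  have "length p \<le> length q" if "apath u q v" for q
    using min_cost_le_walk_cost[of u q v "\<lambda>_. 1"] that p(2)
    by (simp add: cost awalkI_apath)
  with p show ?thesis
    by (auto simp: graph_dist_def cost)
qed

definition transmission :: "('a, 'b) pre_digraph \<Rightarrow> 'a \<Rightarrow> real" where
  "transmission G v = (\<Sum>u\<in>verts G. graph_dist G u v)"

definition max_transmission :: "('a, 'b) pre_digraph \<Rightarrow> real" where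
  "max_transmission G = Max (transmission G ` verts G)"

definition wiener_index :: "('a, 'b) pre_digraph \<Rightarrow> real" where
  "wiener_index G = (\<Sum>u\<in>verts G. \<Sum>v\<in>verts G. graph_dist G u v) / 2"

text \<open>
  Matrices are taken with respect to a list enumerating the vertices; indices start at 0.
\<close>

definition distance_matrix :: "('a, 'b) pre_digraph \<Rightarrow> 'a list \<Rightarrow> real mat" where
  "distance_matrix G vs =
     mat (length vs) (length vs) (\<lambda>(i, j). graph_dist G (vs ! i) (vs ! j))"

definition distance_laplacian :: "('a, 'b) pre_digraph \<Rightarrow> 'a list \<Rightarrow> real mat" where
  "distance_laplacian G vs =
     mat_diag (length vs) (\<lambda>i. transmission G (vs ! i)) - distance_matrix G vs"

text \<open>
  The real eigenvalues of a matrix in descending order, repeated according to their algebraic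
  multiplicity. For a real symmetric matrix these are all the eigenvalues.
\<close>

definition eigenvalues_desc :: "real mat \<Rightarrow> real list" where
  "eigenvalues_desc A = rev (sorted_list_of_multiset (proots (char_poly A)))"

text \<open>
  The eigenvalue $\partial_i^L$ is the list element at position $i - 1$, so
  $\partial_1^L$ and $\partial_{n-1}^L$ are at positions $0$ and $n - 2$.
\<close>

definition distance_laplacian_spread :: "('a, 'b) pre_digraph \<Rightarrow> 'a list \<Rightarrow> real" where
  "distance_laplacian_spread G vs =
     (let es = eigenvalues_desc (distance_laplacian G vs)
      in es ! 0 - es ! (length vs - 2))"

end

theory Submission
  imports Defs "Jordan_Normal_Form.Schur_Decomposition"
begin

text \<open>
  Write $T$ for the maximum transmission and $\partial_1 \ge \dots \ge \partial_n = 0$ for the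
  spectrum, whose sum is the trace $2W$. Bounding each of $\partial_2, \dots, \partial_{n-1}$ from
  below by $\partial_{n-1}$, or each of $\partial_1, \dots, \partial_{n-2}$ from above by
  $\partial_1$, gives
  $((n-1)\partial_1 - 2W)/(n-2) \le \partial_1 - \partial_{n-1} \le (n-1)\partial_1 - 2W$.
  Gershgorin's argument yields $\partial_1 \le 2T$. The Rayleigh quotient at $n e_v - \mathbf{1}$,
  where $v$ has transmission $T$, yields $\partial_1 \ge nT/(n-1) = T + T/(n-1) \ge T + 1$, and
  equality forces $T = n - 1$, so that all distances between distinct vertices are $1$.
\<close>

subsection \<open>Spectral theorem for real symmetric matrices\<close>

text \<open>For an eigenvector v of c, the Hermitian form v* A v equals c times the squared norm of
  v. Since A is real and symmetric, conjugation merely swaps the two summation indices, so the form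
  is real; the norm is real and nonzero, hence c is real.\<close>

lemma eigenvalue_symmetric_real: fixes A :: "real mat" 
  assumes A: "A \<in> carrier_mat n n" and sym: "transpose_mat A = A"
    and ev: "eigenvalue (map_mat complex_of_real A) c"
  shows "c \<in> \<real>"
proof -
  let ?A = "map_mat complex_of_real A"
  have A': "?A \<in> carrier_mat n n" using A by simp
  obtain v where v: "v \<in> carrier_vec n" "v \<noteq> 0\<^sub>v n" "?A *\<^sub>v v = c \<cdot>\<^sub>v v"
    using ev A unfolding eigenvalue_def eigenvector_def by auto
  have symij: "A $$ (i,j) = A $$ (j,i)" if "i < n" "j < n" for i j
    using that A arg_cong[OF sym, of "\<lambda>M. M $$ (i,j)"] by simp
  have sum: "c * v $ i = (\<Sum>j<n. complex_of_real (A $$ (i,j)) * v $ j)" if "i < n" for i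
    using arg_cong[OF v(3), of "\<lambda>w. w $ i"] v(1) A that
    by (simp add: scalar_prod_def atLeast0LessThan)
  let ?N = "\<Sum>i<n. cnj (v $ i) * v $ i"
  let ?Q = "\<Sum>i<n. \<Sum>j<n. cnj (v $ i) * complex_of_real (A $$ (i,j)) * v $ j"
  have "?Q = (\<Sum>i<n. cnj (v $ i) * (c * v $ i))"
    by (simp add: sum sum_distrib_left mult.assoc)
  also have "\<dots> = c * ?N" by (simp add: sum_distrib_left mult.left_commute)
  finally have Q: "?Q = c * ?N" .
  have "cnj ?Q = (\<Sum>i<n. \<Sum>j<n. cnj (v $ j) * complex_of_real (A $$ (j,i)) * v $ i)"
    by (auto simp: symij mult_ac intro!: sum.cong)
  also have "\<dots> = ?Q" by (rule sum.swap)
  finally have cN: "cnj (c * ?N) = c * ?N" unfolding Q .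
  have N: "?N = of_real (\<Sum>i<n. (cmod (v $ i))\<^sup>2)"
    by (simp add: complex_norm_square mult.commute del: of_real_power)
  have nz: "(\<Sum>i<n. (cmod (v $ i))\<^sup>2) \<noteq> 0"
  proof
    assume "(\<Sum>i<n. (cmod (v $ i))\<^sup>2) = 0"
    hence "\<forall>i<n. v $ i = 0" by (subst (asm) sum_nonneg_eq_0_iff) auto
    with v show False by (auto intro: eq_vecI)
  qed
  have "?N \<noteq> 0" and "cnj ?N = ?N"
    using nz by (simp_all add: N del: of_real_sum of_real_power)
  with cN have "cnj c = c" by simp
  thus ?thesis by (simp add: Reals_cnj_iff)
qed

text \<open>Extend v to a basis, apply Gram-Schmidt, which leaves the first vector unchanged, and
  normalise. The scalar \<open>c\<close> is the reciprocal of the norm of v.\<close>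

lemma orthogonal_completion: fixes v :: "real vec"
  assumes v: "v \<in> carrier_vec n" "v \<noteq> 0\<^sub>v n"
  shows "\<exists>W c. W \<in> carrier_mat n n \<and> transpose_mat W * W = 1\<^sub>m n \<and> col W 0 = c \<cdot>\<^sub>v v"
proof -
  interpret cof_vec_space n "TYPE(real)" .
  define b where "b = basis_completion v"
  define ws where "ws = gram_schmidt n b"
  from basis_completion[OF v, folded b_def]
  have b: "distinct b" "\<not> lin_dep (set b)" "set b \<subseteq> carrier_vec n" "hd b = v" "length b = n"
    by auto
  have n: "n \<noteq> 0" using v by (intro notI) auto
  then obtain vs where bv: "b = v # vs" using b by (cases b) auto
  from gram_schmidt_result[OF b(3,1,2) refl, folded ws_def]
  have ws: "set ws \<subseteq> carrier_vec n" "corthogonal ws" "length ws = n"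
    by (auto simp: b)
  have "hd ws = v" using gram_schmidt_hd[OF v(1), of vs, folded bv] unfolding ws_def .
  hence ws0: "ws ! 0 = v" using ws(3) n by (cases ws) auto
  define us where "us = map (\<lambda>w. (1 / sqrt (w \<bullet> w)) \<cdot>\<^sub>v w) ws"
  have wsi: "ws ! i \<in> carrier_vec n" if "i < n" for i using that ws by auto
  have orth: "ws ! i \<bullet> ws ! j = 0 \<longleftrightarrow> i \<noteq> j" if "i < n" "j < n" for i j
  proof -
    \<comment> \<open>Over the reals conjugation is trivial, so \<open>corthogonal\<close> is
      ordinary orthogonality.\<close>
    have "conjugate (ws ! j) = ws ! j" by (rule eq_vecI) auto
    thus ?thesis using corthogonalD[OF ws(2)] that ws(3) by metis
  qed
  have pos: "0 < ws ! i \<bullet> ws ! i" if "i < n" for i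
  proof -
    have "0 \<le> ws ! i \<bullet> ws ! i" by (auto simp: scalar_prod_def intro: sum_nonneg)
    with orth[OF that that] show ?thesis by simp
  qed
  define W where "W = mat_of_cols n us"
  have W: "W \<in> carrier_mat n n" using ws by (simp add: W_def us_def carrier_matI)
  have colW: "col W i = (1 / sqrt (ws ! i \<bullet> ws ! i)) \<cdot>\<^sub>v ws ! i" if "i < n" for i
    unfolding W_def using that ws wsi[OF that] by (subst col_mat_of_cols) (auto simp: us_def)
  have "transpose_mat W * W = 1\<^sub>m n"
  proof (rule eq_matI)
    fix i j assume ij: "i < dim_row (1\<^sub>m n :: real mat)" "j < dim_col (1\<^sub>m n :: real mat)"
    then have "(transpose_mat W * W) $$ (i,j) = col W i \<bullet> col W j"
      using W by simp
    also have "\<dots> = (if i = j then 1 else 0)"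
      using ij orth[of i j] pos[of i] wsi[of i] wsi[of j] by (auto simp: colW)
    finally show "(transpose_mat W * W) $$ (i,j) = 1\<^sub>m n $$ (i,j)" using ij by simp
  qed (use W in auto)
  moreover have "col W 0 = (1 / sqrt (v \<bullet> v)) \<cdot>\<^sub>v v" using colW[of 0] n ws0 by simp
  ultimately show ?thesis using W by blast
qed
text \<open>The fundamental theorem of algebra gives a complex root of the characteristic
  polynomial. By symmetry that root is real, so it is already a root over the reals.\<close>

lemma symmetric_real_eigenvalue_exists: fixes A :: "real mat" 
  assumes A: "A \<in> carrier_mat n n" and sym: "transpose_mat A = A" and n: "n \<noteq> 0"
  shows "\<exists>e. eigenvalue A e"
proof -
  let ?A = "map_mat complex_of_real A"
  have A': "?A \<in> carrier_mat n n" using A by simp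
  have "degree (char_poly ?A) = n" using degree_monic_char_poly[OF A'] by simp
  then obtain c where c: "poly (char_poly ?A) c = 0"
    using n fundamental_theorem_of_algebra_alt[of "char_poly ?A"] by (force simp: degree_pCons_eq_if)
  hence "c \<in> \<real>"
    using eigenvalue_symmetric_real[OF A sym] eigenvalue_root_char_poly[OF A'] by blast
  then obtain e where "c = of_real e" by (auto elim: Reals_cases)
  with c have "poly (char_poly A) e = 0"
    by (simp add: of_real_hom.char_poly_hom[OF A])
  thus ?thesis using eigenvalue_root_char_poly[OF A] by blast
qed

text \<open>Bordering by a 1 commutes with products and transposition. This lifts a diagonalization
  of the lower block to the whole matrix in the induction below.\<close>

lemma four_block_one_orthogonal:
  fixes P :: "'a :: comm_semiring_1 mat"
  assumes P: "P \<in> carrier_mat m m" and B: "B \<in> carrier_mat m m"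
  defines "Q \<equiv> four_block_mat (1\<^sub>m 1) (0\<^sub>m 1 m) (0\<^sub>m m 1) P"
  shows "Q \<in> carrier_mat (Suc m) (Suc m)" 
    and "transpose_mat Q * Q = four_block_mat (1\<^sub>m 1) (0\<^sub>m 1 m) (0\<^sub>m m 1) (transpose_mat P * P)"
    and "Q * four_block_mat (mat 1 1 (\<lambda>_. e)) (0\<^sub>m 1 m) (0\<^sub>m m 1) B * transpose_mat Q
      = four_block_mat (mat 1 1 (\<lambda>_. e)) (0\<^sub>m 1 m) (0\<^sub>m m 1) (P * B * transpose_mat P)"
proof -
  have QT: "transpose_mat Q = four_block_mat (1\<^sub>m 1) (0\<^sub>m 1 m) (0\<^sub>m m 1) (transpose_mat P)"
    unfolding Q_def by (subst transpose_four_block_mat[of _ 1 1 _ m _ m]) (use P in auto)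
  show "Q \<in> carrier_mat (Suc m) (Suc m)" unfolding Q_def using P by auto
  show "transpose_mat Q * Q = four_block_mat (1\<^sub>m 1) (0\<^sub>m 1 m) (0\<^sub>m m 1) (transpose_mat P * P)"
    unfolding QT unfolding Q_def
    by (subst mult_four_block_mat[of _ 1 1 _ m _ m _ _ 1 _ m]) (use P in auto)
  have e: "mat 1 1 (\<lambda>_. e) \<in> carrier_mat 1 1" by simp
  have "Q * four_block_mat (mat 1 1 (\<lambda>_. e)) (0\<^sub>m 1 m) (0\<^sub>m m 1) B
      = four_block_mat (mat 1 1 (\<lambda>_. e)) (0\<^sub>m 1 m) (0\<^sub>m m 1) (P * B)"
    unfolding Q_def
    by (subst mult_four_block_mat[of _ 1 1 _ m _ m _ _ 1 _ m])
      (use P B in \<open>auto simp: left_mult_one_mat[OF e]\<close>)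
  moreover have "four_block_mat (mat 1 1 (\<lambda>_. e)) (0\<^sub>m 1 m) (0\<^sub>m m 1) (P * B) * transpose_mat Q
      = four_block_mat (mat 1 1 (\<lambda>_. e)) (0\<^sub>m 1 m) (0\<^sub>m m 1) (P * B * transpose_mat P)"
    unfolding QT
    by (subst mult_four_block_mat[of _ 1 1 _ m _ m _ _ 1 _ m])
      (use P B in \<open>auto simp: right_mult_one_mat[OF e]\<close>)
  ultimately show "Q * four_block_mat (mat 1 1 (\<lambda>_. e)) (0\<^sub>m 1 m) (0\<^sub>m m 1) B * transpose_mat Q
      = four_block_mat (mat 1 1 (\<lambda>_. e)) (0\<^sub>m 1 m) (0\<^sub>m m 1) (P * B * transpose_mat P)"
    by simp
qed

text \<open>Deflation: in an orthonormal basis starting with an eigenvector, the first column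
  vanishes below the diagonal, and by symmetry so does the rest of the first row. The induction
  hypothesis diagonalizes the remaining symmetric block.\<close>

theorem symmetric_real_diagonalization: fixes A :: "real mat"
  assumes "A \<in> carrier_mat n n" and "transpose_mat A = A"
  shows "\<exists>P f. P \<in> carrier_mat n n \<and> transpose_mat P * P = 1\<^sub>m n
    \<and> A = P * mat_diag n f * transpose_mat P"
  using assms
proof (induction n arbitrary: A)
  case 0
  thus ?case by (intro exI[of _ "1\<^sub>m 0"] exI) (auto intro: eq_matI)
next
  case (Suc m)
  let ?n = "Suc m"
  note A = Suc.prems(1) and sym = Suc.prems(2)
  obtain e where "eigenvalue A e" using symmetric_real_eigenvalue_exists[OF A sym] by auto
  then obtain v where v: "v \<in> carrier_vec ?n" "v \<noteq> 0\<^sub>v ?n" "A *\<^sub>v v = e \<cdot>\<^sub>v v"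
    using A unfolding eigenvalue_def eigenvector_def by auto
  obtain W c where W: "W \<in> carrier_mat ?n ?n" and WW: "transpose_mat W * W = 1\<^sub>m ?n"
    and W0: "col W 0 = c \<cdot>\<^sub>v v"
    using orthogonal_completion[OF v(1,2)] by blast
  have WT: "transpose_mat W \<in> carrier_mat ?n ?n" using W by simp
  have WW': "W * transpose_mat W = 1\<^sub>m ?n" by (rule mat_mult_left_right_inverse[OF WT W WW])
  define B where "B = transpose_mat W * A * W"
  have B: "B \<in> carrier_mat ?n ?n" using A W by (simp add: B_def)
  have BT: "transpose_mat B = B"
    unfolding B_def using A W WT sym
    by (simp add: transpose_mult[of _ ?n ?n _ ?n] assoc_mult_mat[of _ ?n ?n _ ?n _ ?n])
  have AB: "A = W * B * transpose_mat W"
  proof -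
    have "W * B * transpose_mat W = (W * transpose_mat W) * A * (W * transpose_mat W)"
      unfolding B_def using A W WT by (simp add: assoc_mult_mat[of _ ?n ?n _ ?n _ ?n])
    thus ?thesis unfolding WW' using A by simp
  qed
  have AW: "A * W \<in> carrier_mat ?n ?n" using A W by simp
  have "col B 0 = transpose_mat W *\<^sub>v col (A * W) 0"
    unfolding B_def assoc_mult_mat[OF WT A W] by (rule col_mult2[OF WT AW]) simp
  also have "col (A * W) 0 = A *\<^sub>v col W 0" by (rule col_mult2[OF A W]) simp
  also have "A *\<^sub>v col W 0 = e \<cdot>\<^sub>v col W 0"
    using A v by (simp add: W0 mult_mat_vec[of _ ?n ?n] smult_smult_assoc mult.commute)
  also have "transpose_mat W *\<^sub>v (e \<cdot>\<^sub>v col W 0) = e \<cdot>\<^sub>v col (transpose_mat W * W) 0"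
    using col_dim[of W 0] W
    by (subst col_mult2[OF WT W]) (simp_all add: mult_mat_vec[OF WT])
  also have "\<dots> = e \<cdot>\<^sub>v unit_vec ?n 0" unfolding WW by simp
  finally have B0: "col B 0 = e \<cdot>\<^sub>v unit_vec ?n 0" .
  have Bi0: "B $$ (i,0) = (if i = 0 then e else 0)" if "i < ?n" for i
    using arg_cong[OF B0, of "\<lambda>w. w $ i"] that B by (simp add: unit_vec_def)
  have Bsym: "B $$ (i,j) = B $$ (j,i)" if "i < ?n" "j < ?n" for i j
    using that B arg_cong[OF BT, of "\<lambda>M. M $$ (i,j)"] by simp
  define C where "C = mat m m (\<lambda>(i,j). B $$ (Suc i, Suc j))"
  have C: "C \<in> carrier_mat m m" by (simp add: C_def)
  have BC: "B = four_block_mat (mat 1 1 (\<lambda>_. e)) (0\<^sub>m 1 m) (0\<^sub>m m 1) C"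
    using B C Bi0 Bsym[of 0] by (intro eq_matI) (auto simp: C_def)
  have "transpose_mat C = C"
    using Bsym by (intro eq_matI) (auto simp: C_def)
  from Suc.IH[OF C this] obtain R f where R: "R \<in> carrier_mat m m" "transpose_mat R * R = 1\<^sub>m m"
    and CR: "C = R * mat_diag m f * transpose_mat R" by blast
  define Q where "Q = four_block_mat (1\<^sub>m 1) (0\<^sub>m 1 m) (0\<^sub>m m 1) R"
  note Q = four_block_one_orthogonal[OF R(1) mat_diag_dim, folded Q_def]
  have QT: "transpose_mat Q \<in> carrier_mat ?n ?n" using Q(1) by simp
  have QQ: "transpose_mat Q * Q = 1\<^sub>m ?n"
    unfolding Q(2) R(2) by simp
  \<comment> \<open>\<open>case_nat e f\<close> puts the new eigenvalue \<open>e\<close> in front of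
    the eigenvalues \<open>f\<close> of the smaller block.\<close>
  have D: "mat_diag ?n (case_nat e f) = four_block_mat (mat 1 1 (\<lambda>_. e)) (0\<^sub>m 1 m) (0\<^sub>m m 1) (mat_diag m f)"
    by (intro eq_matI) (auto simp: mat_diag_def split: nat.splits)
  obtain D where DD: "D = mat_diag ?n (case_nat e f)" and Dc: "D \<in> carrier_mat ?n ?n" by simp
  have BQ: "B = Q * D * transpose_mat Q"
    unfolding DD BC D CR using Q(3) by simp
  have PT: "transpose_mat (W * Q) = transpose_mat Q * transpose_mat W"
    by (rule transpose_mult[OF W Q(1)])
  show ?case
  proof (intro exI conjI)
    show "W * Q \<in> carrier_mat ?n ?n" using W Q(1) by simp
    have "transpose_mat (W * Q) * (W * Q) = transpose_mat Q * (transpose_mat W * W) * Q"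
      unfolding PT using W WT Q(1) QT by (simp add: assoc_mult_mat[of _ ?n ?n _ ?n _ ?n])
    also have "\<dots> = 1\<^sub>m ?n" unfolding WW using QT QQ by simp
    finally show "transpose_mat (W * Q) * (W * Q) = 1\<^sub>m ?n" .
    show "A = (W * Q) * mat_diag ?n (case_nat e f) * transpose_mat (W * Q)"
      unfolding PT AB[unfolded BQ] DD[symmetric] using W WT Q(1) QT Dc
      by (simp add: assoc_mult_mat[of _ ?n ?n _ ?n _ ?n])
  qed
qed

section \<open>Spectrum, trace and Rayleigh quotient of a diagonalized matrix\<close>

text \<open>The transpose of P is its inverse, so A is similar to the diagonal matrix and shares its
  characteristic polynomial, a product of linear factors.\<close>

lemma proots_char_poly_diagonalization: fixes A :: "'a :: idom mat"
  assumes P: "P \<in> carrier_mat n n" "transpose_mat P * P = 1\<^sub>m n"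
    and A: "A = P * mat_diag n f * transpose_mat P"
    and PP: "P * transpose_mat P = 1\<^sub>m n"
  shows "proots (char_poly A) = mset (map f [0..<n])"
proof -
  have D: "mat_diag n f \<in> carrier_mat n n" by simp
  have "similar_mat A (mat_diag n f)"
    by (rule similar_matI[of _ _ P "transpose_mat P" n]) (use P A PP in auto)
  hence "char_poly A = char_poly (mat_diag n f)" by (rule char_poly_similar)
  also have "\<dots> = (\<Prod>a\<leftarrow>diag_mat (mat_diag n f). [:- a, 1:])"
    by (rule char_poly_upper_triangular[OF D]) (auto simp: mat_diag_def)
  also have "diag_mat (mat_diag n f) = map f [0..<n]"
    by (simp add: diag_mat_def mat_diag_def)
  finally have cp: "char_poly A = prod_list (map (\<lambda>a. [:- a, 1:]) (map f [0..<n]))" .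
  have nz: "0 \<notin> set (map (\<lambda>a. [:- a, 1:]) (map f [0..<n]))" by auto
  have "proots (char_poly A) = (\<Sum>a\<leftarrow>map f [0..<n]. {#a#})"
    using proots_prod_list[OF nz] by (simp add: cp comp_def)
  also have "\<dots> = mset (map f [0..<n])" by (induction n) auto
  finally show ?thesis .
qed

text \<open>After exchanging the sums, each \<open>f k\<close> is weighted by the squared length of
  column k of P, which is 1.\<close>

lemma trace_diagonalization: fixes f :: "nat \<Rightarrow> 'a :: comm_ring_1"
  assumes P: "P \<in> carrier_mat n n" "transpose_mat P * P = 1\<^sub>m n"
  shows "(\<Sum>i<n. (P * mat_diag n f * transpose_mat P) $$ (i,i)) = (\<Sum>k<n. f k)"
proof -
  have PT: "transpose_mat P \<in> carrier_mat n n" using P by simp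
  have "(\<Sum>i<n. (P * mat_diag n f * transpose_mat P) $$ (i,i)) = (\<Sum>i<n. \<Sum>k<n. P $$ (i,k) * f k * P $$ (i,k))"
    using P(1) by (intro sum.cong refl) (simp add: mat_diag_mult_right[OF P(1)] scalar_prod_def atLeast0LessThan)
  also have "\<dots> = (\<Sum>k<n. f k * (\<Sum>i<n. P $$ (i,k) * P $$ (i,k)))"
    by (subst sum.swap) (simp add: sum_distrib_left mult_ac)
  also have "\<dots> = (\<Sum>k<n. f k * (transpose_mat P * P) $$ (k,k))"
    using P(1) by (intro sum.cong refl) (simp add: scalar_prod_def atLeast0LessThan)
  finally show ?thesis unfolding P(2) by simp
qed

text \<open>In the coordinates y = P^T x the form becomes the sum of \<open>f k\<close> times the
  square of the k-th coordinate, while the orthogonal change of basis preserves the norm.\<close>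

lemma rayleigh_diagonalization: fixes f :: "nat \<Rightarrow> real"
  assumes P: "P \<in> carrier_mat n n" and PP: "P * transpose_mat P = 1\<^sub>m n"
    and x: "x \<in> carrier_vec n" and f: "\<And>k. k < n \<Longrightarrow> f k \<le> M"
  shows "x \<bullet> ((P * mat_diag n f * transpose_mat P) *\<^sub>v x) \<le> M * (x \<bullet> x)"
proof -
  have PT: "transpose_mat P \<in> carrier_mat n n" using P by simp
  define y where "y = transpose_mat P *\<^sub>v x"
  have y: "y \<in> carrier_vec n" using PT x by (auto simp: y_def)
  have D: "mat_diag n f \<in> carrier_mat n n" by simp
  have Dy: "mat_diag n f *\<^sub>v y = vec n (\<lambda>k. f k * y $ k)"
    using y by (intro eq_vecI) (auto simp: mat_diag_def scalar_prod_def if_distrib[of "\<lambda>x. x * _"] cong: if_cong)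
  have "x \<bullet> ((P * mat_diag n f * transpose_mat P) *\<^sub>v x) = x \<bullet> (P *\<^sub>v (mat_diag n f *\<^sub>v y))"
    unfolding y_def using P PT D x by (simp add: assoc_mult_mat_vec[of _ n n _ n])
  also have "\<dots> = y \<bullet> (mat_diag n f *\<^sub>v y)"
    unfolding y_def
    by (rule transpose_vec_mult_scalar[symmetric, OF P _ x])
      (rule mult_mat_vec_carrier[OF D y[unfolded y_def]])
  also have "\<dots> = (\<Sum>k<n. f k * (y $ k)\<^sup>2)"
    unfolding Dy using y by (auto simp: scalar_prod_def atLeast0LessThan power2_eq_square intro!: sum.cong)
  also have "\<dots> \<le> (\<Sum>k<n. M * (y $ k)\<^sup>2)" by (intro sum_mono mult_right_mono f) auto
  also have "\<dots> = M * (y \<bullet> y)"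
    using y by (simp add: scalar_prod_def atLeast0LessThan power2_eq_square sum_distrib_left)
  also have "y \<bullet> y = x \<bullet> (P *\<^sub>v y)"
    by (subst (1) y_def) (rule transpose_vec_mult_scalar[OF P y x])
  also have "P *\<^sub>v y = x"
    unfolding y_def using P PT x by (simp add: assoc_mult_mat_vec[of _ n n _ n, symmetric] PP)
  finally show ?thesis .
qed

text \<open>Collects what the spectral theorem says about \<open>eigenvalues_desc\<close>; the list
  is the diagonal of any orthogonal diagonalization, sorted in descending order.\<close>

lemma eigenvalues_desc_symmetric:
  assumes A: "A \<in> carrier_mat n n" and sym: "transpose_mat A = A"
  defines "es \<equiv> eigenvalues_desc A"
  shows "length es = n" and "sorted_wrt (\<ge>) es" and "set es = {e. eigenvalue A e}"
    and "sum_list es = (\<Sum>i<n. A $$ (i,i))"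
    and "x \<in> carrier_vec n \<Longrightarrow> n \<noteq> 0 \<Longrightarrow> x \<bullet> (A *\<^sub>v x) \<le> es ! 0 * (x \<bullet> x)"
proof -
  obtain P f where P: "P \<in> carrier_mat n n" "transpose_mat P * P = 1\<^sub>m n"
    and APf: "A = P * mat_diag n f * transpose_mat P"
    using symmetric_real_diagonalization[OF A sym] by blast
  have PP: "P * transpose_mat P = 1\<^sub>m n"
    using P by (intro mat_mult_left_right_inverse[of "transpose_mat P" n]) auto
  have proots: "proots (char_poly A) = mset (map f [0..<n])"
    by (rule proots_char_poly_diagonalization[OF P APf PP])
  have es: "es = rev (sort (map f [0..<n]))"
    unfolding es_def eigenvalues_desc_def proots by (simp only: sorted_list_of_multiset_mset)
  show "length es = n" by (simp add: es)
  show sorted: "sorted_wrt (\<ge>) es" by (simp add: es sorted_wrt_rev)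
  have "char_poly A \<noteq> 0" using degree_monic_char_poly[OF A] by auto
  hence "set_mset (proots (char_poly A)) = {e. eigenvalue A e}"
    by (simp add: eigenvalue_root_char_poly[OF A])
  thus "set es = {e. eigenvalue A e}" unfolding proots by (simp add: es)
  have "sum_list es = sum_list (map f [0..<n])"
    by (metis es mset_rev mset_sort sum_mset_sum_list)
  thus "sum_list es = (\<Sum>i<n. A $$ (i,i))"
    unfolding APf trace_diagonalization[OF P] by (simp add: sum_list_distinct_conv_sum_set atLeast0LessThan)
  assume x: "x \<in> carrier_vec n" and n: "n \<noteq> 0"
  have "f k \<le> es ! 0" if "k < n" for k
  proof -
    from that have "f k \<in> set es" by (auto simp: es)
    with sorted show ?thesis by (cases es) auto
  qed
  thus "x \<bullet> (A *\<^sub>v x) \<le> es ! 0 * (x \<bullet> x)"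
    unfolding APf by (rule rayleigh_diagonalization[OF P(1) PP x])
qed

subsection \<open>Laplacians of weighted graphs\<close>

text \<open>With \<open>w\<close> the distances between enumerated vertices this is the distance
  Laplacian. Weights on index pairs let the spectral estimates be carried out apart from
  graphs.\<close>

definition weighted_laplacian :: "nat \<Rightarrow> (nat \<Rightarrow> nat \<Rightarrow> real) \<Rightarrow> real mat" where
  "weighted_laplacian n w = mat_diag n (\<lambda>i. \<Sum>k<n. w i k) - mat n n (\<lambda>(i, j). w i j)"

lemma weighted_laplacian_carrier: "weighted_laplacian n w \<in> carrier_mat n n"
  by (auto simp: weighted_laplacian_def mat_diag_def)

lemma weighted_laplacian_index:
  "i < n \<Longrightarrow> j < n \<Longrightarrow>
    weighted_laplacian n w $$ (i,j) = (if i = j then \<Sum>k<n. w i k else 0) - w i j"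
  by (auto simp: weighted_laplacian_def mat_diag_def)

lemma weighted_laplacian_mult_vec:
  assumes "x \<in> carrier_vec n" "i < n"
  shows "(weighted_laplacian n w *\<^sub>v x) $ i = (\<Sum>j<n. w i j) * x $ i - (\<Sum>j<n. w i j * x $ j)"
proof -
  have "(weighted_laplacian n w *\<^sub>v x) $ i = (\<Sum>j<n. weighted_laplacian n w $$ (i,j) * x $ j)"
    using assms weighted_laplacian_carrier[of n w] by (simp add: scalar_prod_def atLeast0LessThan)
  also have "\<dots> = (\<Sum>j<n. (if i = j then (\<Sum>k<n. w i k) * x $ j else 0) - w i j * x $ j)"
    using assms(2) by (intro sum.cong) (auto simp: weighted_laplacian_index algebra_simps)
  finally show ?thesis using assms(2) by (simp add: sum_subtractf)
qed

lemma weighted_laplacian_sym: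
  assumes "\<And>i j. i < n \<Longrightarrow> j < n \<Longrightarrow> w i j = w j i"
  shows "transpose_mat (weighted_laplacian n w) = weighted_laplacian n w"
  using weighted_laplacian_carrier[of n w] assms
  by (intro eq_matI) (auto simp: weighted_laplacian_index)

text \<open>All rows sum to zero, so the all-ones vector lies in the kernel.\<close>

lemma weighted_laplacian_eigenvalue_0:
  assumes "n \<noteq> 0"
  shows "eigenvalue (weighted_laplacian n w) 0"
proof -
  have "weighted_laplacian n w *\<^sub>v vec n (\<lambda>_. 1) = 0 \<cdot>\<^sub>v vec n (\<lambda>_. 1)"
    using weighted_laplacian_carrier[of n w]
    by (intro eq_vecI) (auto simp: weighted_laplacian_mult_vec simp del: index_mult_mat_vec)
  moreover have "vec n (\<lambda>_. 1) \<noteq> (0\<^sub>v n :: real vec)"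
    using assms by (auto dest: arg_cong[of _ _ "\<lambda>v. v $ 0"])
  ultimately show ?thesis
    using weighted_laplacian_carrier[of n w]
    unfolding eigenvalue_def eigenvector_def by (intro exI[of _ "vec n (\<lambda>_. 1)"]) auto
qed

lemma weighted_laplacian_eigenvector:
  assumes "eigenvalue (weighted_laplacian n w) e"
  obtains x where "x \<in> carrier_vec n" "x \<noteq> 0\<^sub>v n"
    "\<And>i. i < n \<Longrightarrow> e * x $ i = (\<Sum>j<n. w i j) * x $ i - (\<Sum>j<n. w i j * x $ j)"
proof -
  obtain x where x: "x \<in> carrier_vec n" "x \<noteq> 0\<^sub>v n" "weighted_laplacian n w *\<^sub>v x = e \<cdot>\<^sub>v x"
    using assms weighted_laplacian_carrier[of n w] unfolding eigenvalue_def eigenvector_def by auto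
  have "e * x $ i = (\<Sum>j<n. w i j) * x $ i - (\<Sum>j<n. w i j * x $ j)" if "i < n" for i
    using weighted_laplacian_mult_vec[OF x(1) that, of w] x(1) that unfolding x(3) by simp
  with x show ?thesis using that by blast
qed

text \<open>Gershgorin's argument: at a coordinate where an eigenvector has maximal modulus, the
  eigenvalue differs from the row sum t by at most t, hence lies between 0 and 2t.\<close>

lemma weighted_laplacian_eigenvalue_bounds:
  assumes w: "\<And>i j. i < n \<Longrightarrow> j < n \<Longrightarrow> 0 \<le> w i j"
    and T: "\<And>i. i < n \<Longrightarrow> (\<Sum>j<n. w i j) \<le> T"
    and e: "eigenvalue (weighted_laplacian n w) e"
  shows "0 \<le> e" "e \<le> 2 * T"
proof -
  obtain x where x: "x \<in> carrier_vec n" "x \<noteq> 0\<^sub>v n"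
    "\<And>i. i < n \<Longrightarrow> e * x $ i = (\<Sum>j<n. w i j) * x $ i - (\<Sum>j<n. w i j * x $ j)"
    using weighted_laplacian_eigenvector[OF e] by metis
  have n: "n \<noteq> 0" using x(1,2) by (intro notI) auto
  define m where "m = Max ((\<lambda>i. \<bar>x $ i\<bar>) ` {..<n})"
  have m: "\<bar>x $ j\<bar> \<le> m" if "j < n" for j
    unfolding m_def using that by (intro Max_ge) auto
  have "m \<in> (\<lambda>i. \<bar>x $ i\<bar>) ` {..<n}" unfolding m_def using n by (intro Max_in) auto
  then obtain i where i: "i < n" "\<bar>x $ i\<bar> = m" by auto
  have "m \<noteq> 0"
  proof
    assume "m = 0"
    with m have "x = 0\<^sub>v n" using x(1) by (intro eq_vecI) auto
    with x(2) show False by simp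
  qed
  with i have m0: "m > 0" by auto
  define t where "t = (\<Sum>j<n. w i j)"
  \<comment> \<open>Row \<open>i\<close> of the eigenvector equation, solved for (t - e) times the
    maximal coordinate.\<close>
  have "\<bar>t - e\<bar> * m = \<bar>\<Sum>j<n. w i j * x $ j\<bar>"
    using x(3)[OF i(1)] by (simp add: t_def i(2)[symmetric] abs_mult[symmetric] algebra_simps)
  also have "\<dots> \<le> (\<Sum>j<n. \<bar>w i j * x $ j\<bar>)" by (rule sum_abs)
  also have "\<dots> \<le> (\<Sum>j<n. w i j * m)"
    using w[OF i(1)] m by (intro sum_mono) (auto simp: abs_mult intro!: mult_left_mono)
  also have "\<dots> = t * m" by (simp add: t_def sum_distrib_right)
  finally have "\<bar>t - e\<bar> \<le> t" using m0 by simp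
  thus "0 \<le> e" "e \<le> 2 * T" using T[OF i(1)] by (auto simp: t_def)
qed

text \<open>Here the Laplacian is n I - J with J the all-ones matrix. Summing the eigenvector
  equation over all rows gives e s = 0, where s is the coordinate sum; if s = 0, a nonzero
  coordinate forces e = n.\<close>

lemma complete_laplacian_eigenvalue_le:
  assumes w: "\<And>i j. i < n \<Longrightarrow> j < n \<Longrightarrow> w i j = (if i = j then 0 else 1)"
    and e: "eigenvalue (weighted_laplacian n w) e"
  shows "e \<le> real n"
proof -
  obtain x where x: "x \<in> carrier_vec n" "x \<noteq> 0\<^sub>v n"
    "\<And>i. i < n \<Longrightarrow> e * x $ i = (\<Sum>j<n. w i j) * x $ i - (\<Sum>j<n. w i j * x $ j)"
    using weighted_laplacian_eigenvector[OF e] by metis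
  define s where "s = (\<Sum>j<n. x $ j)"
  have row: "(\<Sum>j<n. w i j * y j) = (\<Sum>j<n. y j) - y i" if "i < n" for i y
  proof -
    have "(\<Sum>j<n. w i j * y j) = (\<Sum>j<n. y j - (if i = j then y j else 0))"
      using that by (intro sum.cong) (auto simp: w)
    thus ?thesis using that by (simp add: sum_subtractf)
  qed
  have ex: "e * x $ i = real n * x $ i - s" if "i < n" for i
  proof -
    have "e * x $ i = (real n - 1) * x $ i - (s - x $ i)"
      using x(3)[OF that] row[OF that, of "\<lambda>_. 1"] row[OF that, of "\<lambda>j. x $ j"]
      by (simp add: s_def)
    thus ?thesis by (simp add: algebra_simps)
  qed
  have "e * s = (\<Sum>i<n. real n * x $ i - s)"
    unfolding s_def sum_distrib_left using ex by (intro sum.cong) (auto simp: s_def)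
  also have "\<dots> = 0" by (simp add: sum_subtractf s_def sum_distrib_left)
  finally consider "e = 0" | "s = 0" by auto
  thus ?thesis
  proof cases
    case 2
    obtain i where "i < n" "x $ i \<noteq> 0"
      using x(1,2) by (metis carrier_vecD eq_vecI index_zero_vec)
    with ex[of i] 2 show ?thesis by simp
  qed simp
qed

text \<open>The test vector is n e_v - 1. The Laplacian is symmetric and kills constants, so only
  n^2 times its diagonal entry at v survives, and that entry is the row sum because
  \<open>w v v\<close> is 0.\<close>

lemma weighted_laplacian_rayleigh:
  assumes sym: "\<And>i j. i < n \<Longrightarrow> j < n \<Longrightarrow> w i j = w j i"
    and v: "v < n" and wv: "w v v = 0"
  defines "x \<equiv> vec n (\<lambda>i. if i = v then real n - 1 else -1)"
  shows "x \<bullet> (weighted_laplacian n w *\<^sub>v x) = (real n)\<^sup>2 * (\<Sum>j<n. w v j)"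
    and "x \<bullet> x = real n * (real n - 1)"
proof -
  define t where "t = (\<Sum>j<n. w v j)"
  have xi: "x $ i = (if i = v then real n else 0) - 1" if "i < n" for i
    using that by (auto simp: x_def)
  have x: "x \<in> carrier_vec n" by (simp add: x_def)
  \<comment> \<open>Pairing any y with the test vector gives n times its entry at \<open>v\<close>
    minus its total; all later sums reduce to this.\<close>
  have sumx: "(\<Sum>j<n. y j * x $ j) = real n * y v - (\<Sum>j<n. y j)" for y :: "nat \<Rightarrow> real"
  proof -
    have "(\<Sum>j<n. y j * x $ j) = (\<Sum>j<n. (if v = j then real n * y j else 0) - y j)"
      by (intro sum.cong) (auto simp: xi algebra_simps)
    thus ?thesis using v by (simp add: sum_subtractf)
  qed
  have Lx: "(weighted_laplacian n w *\<^sub>v x) $ i = (if i = v then real n * t else 0) - real n * w i v"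
    if "i < n" for i
    unfolding weighted_laplacian_mult_vec[OF x that] sumx
    using that by (auto simp: xi t_def algebra_simps)
  have "x \<bullet> (weighted_laplacian n w *\<^sub>v x) = (\<Sum>i<n. (weighted_laplacian n w *\<^sub>v x) $ i * x $ i)"
    using weighted_laplacian_carrier[of n w]
    by (simp add: scalar_prod_def atLeast0LessThan mult.commute del: index_mult_mat_vec)
  also have "\<dots> = (\<Sum>i<n. ((if i = v then real n * t else 0) - real n * w i v) * x $ i)"
    by (intro sum.cong) (auto simp: Lx)
  also have "\<dots> = real n * (real n * t) - (real n * t - real n * (\<Sum>i<n. w i v))"
    using v wv by (simp add: sumx sum_subtractf sum_distrib_left)
  also have "(\<Sum>i<n. w i v) = t" unfolding t_def using sym v by (intro sum.cong) auto
  finally show "x \<bullet> (weighted_laplacian n w *\<^sub>v x) = (real n)\<^sup>2 * (\<Sum>j<n. w v j)"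
    by (simp add: t_def power2_eq_square)
  have "x \<bullet> x = (\<Sum>i<n. x $ i * x $ i)" using x by (simp add: scalar_prod_def atLeast0LessThan)
  also have "\<dots> = real n * x $ v - (\<Sum>i<n. 1 * x $ i)" by (subst sumx) simp
  also have "\<dots> = real n * (real n - 1)" by (subst sumx) (simp add: xi[OF v] algebra_simps)
  finally show "x \<bullet> x = real n * (real n - 1)" .
qed

text \<open>The final entry contributes nothing. Replacing positions 1 to m by the smallest of these
  entries, or positions 0 to m - 1 by the largest, bounds the sum. For a Laplacian spectrum with n =
  m + 2, position m holds the eigenvalue numbered n - 1.\<close>

lemma spread_bounds_sum_list:
  fixes es :: "real list"
  assumes len: "length es = Suc (Suc m)" and sorted: "sorted_wrt (\<ge>) es" and last: "es ! Suc m = 0"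
  shows "es ! 0 + real m * es ! m \<le> sum_list es" "sum_list es \<le> es ! m + real m * es ! 0"
proof -
  have anti: "es ! j \<le> es ! i" if "i \<le> j" "j \<le> Suc m" for i j
    using sorted_wrt_nth_less[OF sorted, of i j] that len by (cases "i = j") auto
  have S: "sum_list es = (\<Sum>i<Suc m. es ! i)"
    using last len by (simp add: sum_list_sum_nth atLeast0LessThan)
  have "(\<Sum>i<m. es ! i) \<le> (\<Sum>i<m. es ! 0)" by (intro sum_mono anti) auto
  thus "sum_list es \<le> es ! m + real m * es ! 0" unfolding S by simp
  have "(\<Sum>i<m. es ! Suc i) \<ge> (\<Sum>i<m. es ! m)" by (intro sum_mono anti) auto
  thus "es ! 0 + real m * es ! m \<le> sum_list es"
    unfolding S sum.lessThan_Suc_shift by simp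
qed

subsection \<open>Graph distance\<close>

text \<open>Every arc has an opposite arc, which is appended to the reversal of the remaining walk.
  This is the source of the symmetry of distances.\<close>

lemma (in sym_digraph) awalk_reverse:
  "awalk u p v \<Longrightarrow> \<exists>q. awalk v q u \<and> length q = length p"
proof (induction p arbitrary: u)
  case Nil
  thus ?case by (auto simp: awalk_Nil_iff)
next
  case (Cons e p)
  hence e: "e \<in> arcs G" "u = tail G e" and p: "awalk (head G e) p v" by (auto simp: awalk_Cons_iff)
  obtain e' where e': "e' \<in> arcs G" "tail G e' = head G e" "head G e' = u"
    using sym_arcs e unfolding symmetric_conv by metis
  from Cons.IH[OF p] obtain q where "awalk v q (head G e)" "length q = length p" by blast
  with arc_implies_awalk[OF e'(1)] e' show ?case
    by (intro exI[of _ "q @ [e']"]) (auto intro: awalk_appendI)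
qed

text \<open>The infimum defining the distance is attained by a walk, so it is finite and the
  conversion by \<open>real_of_ereal\<close> preserves the comparison.\<close>

lemma (in fin_digraph) graph_dist_le_awalk:
  assumes "awalk u p v"
  shows "graph_dist G u v \<le> real (length p)"
proof -
  have reach: "u \<rightarrow>\<^sup>* v" using assms by (auto simp: reachable_awalk)
  obtain q where q: "\<mu> (\<lambda>_. 1) u v = awalk_cost (\<lambda>_. 1) q"
    using min_cost_awalk[OF reach, of "\<lambda>_. 1"] by auto
  have "awalk_cost (\<lambda>_. 1) p = real (length p)" by (induction p) auto
  thus ?thesis using min_cost_le_walk_cost[OF assms, of "\<lambda>_. 1"] q by (simp add: graph_dist_def)
qed

lemma (in fin_digraph) graph_dist_awalk:
  assumes "u \<rightarrow>\<^sup>* v"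
  shows "\<exists>p. awalk u p v \<and> graph_dist G u v = real (length p)"
  using graph_dist_shortest_path[OF assms] by (auto intro: awalkI_apath)

lemma (in fin_digraph) graph_dist_self:
  assumes "u \<in> verts G"
  shows "graph_dist G u u = 0"
proof -
  have "u \<rightarrow>\<^sup>* u" using assms by simp
  from graph_dist_awalk[OF this] have "graph_dist G u u \<ge> 0" by auto
  moreover have "graph_dist G u u \<le> 0"
    using graph_dist_le_awalk[of u "[]" u] assms by (simp add: awalk_Nil_iff)
  ultimately show ?thesis by simp
qed

lemma (in graph) graph_dist_sym:
  assumes "u \<rightarrow>\<^sup>* v"
  shows "graph_dist G u v = graph_dist G v u"
proof -
  have le: "graph_dist G y x \<le> graph_dist G x y" if "x \<rightarrow>\<^sup>* y" for x y
    using graph_dist_awalk[OF that] awalk_reverse graph_dist_le_awalk by metis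
  show ?thesis using le[OF assms] le[OF symmetric_reachable'[OF assms]] by simp
qed

lemma (in fin_digraph) graph_dist_ge_1:
  assumes "u \<rightarrow>\<^sup>* v" "u \<noteq> v"
  shows "graph_dist G u v \<ge> 1"
proof -
  obtain p where p: "awalk u p v" "graph_dist G u v = real (length p)"
    using graph_dist_awalk[OF assms(1)] by blast
  with assms(2) have "p \<noteq> []" by (auto simp: awalk_Nil_iff)
  with p(2) show ?thesis by (cases p) auto
qed

lemma (in fin_digraph) graph_dist_eq_1_iff:
  assumes "u \<rightarrow>\<^sup>* v" "u \<noteq> v"
  shows "graph_dist G u v = 1 \<longleftrightarrow> (u, v) \<in> arcs_ends G"
proof
  assume "graph_dist G u v = 1"
  then obtain p where "awalk u p v" "length p = 1"
    using graph_dist_awalk[OF assms(1)] by auto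
  then obtain e where "awalk u [e] v" by (auto simp: length_Suc_conv)
  thus "(u, v) \<in> arcs_ends G" by (auto simp: awalk_simps arcs_ends_conv)
next
  assume "(u, v) \<in> arcs_ends G"
  then obtain e where "e \<in> arcs G" "u = tail G e" "v = head G e" by (auto simp: arcs_ends_conv)
  hence "awalk u [e] v" by (simp add: awalk_simps)
  from graph_dist_le_awalk[OF this] graph_dist_ge_1[OF assms]
  show "graph_dist G u v = 1" by simp
qed

text \<open>\<open>connected\<close> is strong connectivity of the symmetric closure, and the arcs
  of a graph are already symmetric.\<close>

lemma (in graph) connected_reachable:
  assumes "connected G" "u \<in> verts G" "v \<in> verts G"
  shows "u \<rightarrow>\<^sup>* v"
  using assms reachable_mk_symmetric_eq[OF sym_arcs]
  by (auto simp: connected_def strongly_connected_def)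

lemma sum_distinct_nth:
  assumes "distinct vs"
  shows "(\<Sum>x\<in>set vs. g x) = (\<Sum>k<length vs. g (vs ! k))"
  using assms by (simp add: sum.distinct_set_conv_list sum_list_sum_nth atLeast0LessThan)

text \<open>Distance 1 between distinct vertices means adjacency. Conversely, arcs never join a
  vertex to itself, so \<open>arcs_ends\<close> consists of pairs of distinct vertices only.\<close>

lemma complete_digraph_iff_graph_dist:
  assumes "graph G" and conn: "Digraph_Component.connected G"
  shows "complete_digraph (card (verts G)) G
    \<longleftrightarrow> (\<forall>u\<in>verts G. \<forall>v\<in>verts G. u \<noteq> v \<longrightarrow> graph_dist G u v = 1)"
proof -
  interpret graph G by fact
  have "graph_dist G u v = 1 \<longleftrightarrow> (u, v) \<in> arcs_ends G" if "u \<in> verts G" "v \<in> verts G" "u \<noteq> v" for u v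
    using graph_dist_eq_1_iff connected_reachable[OF conn] that by blast
  moreover have "u \<in> verts G \<and> v \<in> verts G \<and> u \<noteq> v" if "(u, v) \<in> arcs_ends G" for u v
    using that no_loops by (auto simp: arcs_ends_conv)
  ultimately show ?thesis
    unfolding complete_digraph_def using \<open>graph G\<close> by blast
qed

section \<open>Bounds on the spread and the case of equality\<close>

theorem theorem3p2:
  fixes G :: "('a, 'b) pre_digraph" and vs :: "'a list" and n :: nat
  assumes "graph G"
    and "Digraph_Component.connected G"
    and "card (verts G) = n"
    and "n \<ge> 3"
    and "distinct vs" and "set vs = verts G"
  shows "((real n - 1) * (max_transmission G + 1) - 2 * wiener_index G) / (real n - 2)
           \<le> distance_laplacian_spread G vs
       \<and> distance_laplacian_spread G vs
           \<le> 2 * (real n - 1) * max_transmission G - 2 * wiener_index G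
       \<and> (((real n - 1) * (max_transmission G + 1) - 2 * wiener_index G) / (real n - 2)
             = distance_laplacian_spread G vs
           \<longleftrightarrow> complete_digraph n G)"
proof -
  interpret graph G by fact
  note conn = assms(2) and cardn = assms(3) and n3 = assms(4) and dist = assms(5) and setvs = assms(6)
  have len: "length vs = n" using distinct_card[OF dist] setvs cardn by simp
  define w where "w i j = graph_dist G (vs ! i) (vs ! j)" for i j
  define L where "L = weighted_laplacian n w"
  define T where "T = max_transmission G"
  define W where "W = wiener_index G"
  define es where "es = eigenvalues_desc L"
  \<comment> \<open>m = n - 2 is both the denominator of the lower bound, positive since n is at
    least 3, and the list position of the second smallest eigenvalue.\<close>
  obtain m where m: "n = Suc (Suc m)" "m \<ge> 1" using n3 by (intro that[of "n - 2"]) auto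
  have vsi: "vs ! i \<in> verts G" if "i < n" for i using nth_mem[of i vs] that len setvs by simp
  have reach: "vs ! i \<rightarrow>\<^sup>*\<^bsub>G\<^esub> vs ! j" if "i < n" "j < n" for i j
    using connected_reachable[OF conn] vsi that by blast
  have vs_eq: "vs ! i = vs ! j \<longleftrightarrow> i = j" if "i < n" "j < n" for i j
    using nth_eq_iff_index_eq[OF dist] that len by simp
  have wsym: "w i j = w j i" if "i < n" "j < n" for i j
    unfolding w_def by (rule graph_dist_sym[OF reach[OF that]])
  have wii: "w i i = 0" if "i < n" for i
    unfolding w_def by (rule graph_dist_self[OF vsi[OF that]])
  have w1: "w i j \<ge> 1" if "i < n" "j < n" "i \<noteq> j" for i j
    unfolding w_def using graph_dist_ge_1[OF reach[OF that(1,2)]] vs_eq that by blast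
  have w0: "w i j \<ge> 0" if "i < n" "j < n" for i j
    using w1[OF that] wii[of i] that by (cases "i = j") auto
  have sumG: "(\<Sum>u\<in>verts G. g u) = (\<Sum>k<n. g (vs ! k))" for g :: "'a \<Rightarrow> real"
    using sum_distinct_nth[OF dist] setvs len by metis
  \<comment> \<open>\<open>transmission\<close> sums over the first argument of the distance, the
    row sum over the second; symmetry reconciles them.\<close>
  have tr: "transmission G (vs ! i) = (\<Sum>j<n. w i j)" if "i < n" for i
    unfolding transmission_def sumG w_def[symmetric] using wsym that by (intro sum.cong) auto
  have L: "distance_laplacian G vs = L"
    unfolding L_def distance_laplacian_def distance_matrix_def weighted_laplacian_def
    by (rule eq_matI) (auto simp: len mat_diag_def tr w_def)
  have verts: "verts G = (\<lambda>i. vs ! i) ` {..<n}"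
    using setvs len by (auto simp: set_conv_nth)
  have T_ge: "(\<Sum>j<n. w i j) \<le> T" if "i < n" for i
    unfolding T_def max_transmission_def tr[OF that, symmetric] using vsi[OF that] by (intro Max_ge) auto
  have "T \<in> transmission G ` verts G"
    unfolding T_def max_transmission_def using n3 cardn by (intro Max_in) auto
  then obtain v where v: "v < n" "T = (\<Sum>j<n. w v j)" by (auto simp: verts tr)
  \<comment> \<open>The excess of a transmission over n - 1 is a sum of nonnegative terms, and it
    vanishes exactly when all distances from that vertex to the others are 1.\<close>
  have deficit: "(\<Sum>j<n. w i j) - (real n - 1) = (\<Sum>j\<in>{..<n} - {i}. w i j - 1)" if "i < n" for i
  proof -
    have "(\<Sum>j<n. w i j) = (\<Sum>j\<in>{..<n} - {i}. w i j)"
      using that wii by (subst sum.remove[of _ i]) auto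
    thus ?thesis using that by (simp add: sum_subtractf of_nat_diff)
  qed
  have T_ge_n: "T \<ge> real n - 1"
  proof -
    have "0 \<le> (\<Sum>j\<in>{..<n} - {v}. w v j - 1)" using w1 v(1) by (intro sum_nonneg) auto
    with deficit[OF v(1)] v(2) show ?thesis by simp
  qed
  have complete_iff: "complete_digraph n G \<longleftrightarrow> (\<forall>i<n. \<forall>j<n. i \<noteq> j \<longrightarrow> w i j = 1)"
    unfolding complete_digraph_iff_graph_dist[OF assms(1) conn, unfolded cardn] verts w_def
    by (auto simp: vs_eq)
  have T_eq: "T = real n - 1 \<longleftrightarrow> complete_digraph n G"
  proof
    assume T: "T = real n - 1"
    have "w i j = 1" if "i < n" "j < n" "i \<noteq> j" for i j
    proof -
      have nonneg: "0 \<le> w i k - 1" if "k \<in> {..<n} - {i}" for k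
        using w1[OF \<open>i < n\<close>, of k] that by auto
      have "(\<Sum>k\<in>{..<n} - {i}. w i k - 1) = 0"
        using deficit[OF that(1)] T_ge[OF that(1)] T
          sum_nonneg[of "{..<n} - {i}" "\<lambda>k. w i k - 1", OF nonneg] by linarith
      hence "\<forall>k\<in>{..<n} - {i}. w i k - 1 = 0"
        using nonneg by (subst (asm) sum_nonneg_eq_0_iff) auto
      thus ?thesis using that by auto
    qed
    thus "complete_digraph n G" by (simp add: complete_iff)
  next
    assume "complete_digraph n G"
    hence "(\<Sum>j\<in>{..<n} - {v}. w v j - 1) = 0" using v(1) unfolding complete_iff by (intro sum.neutral) auto
    with deficit[OF v(1)] v(2) show "T = real n - 1" by simp
  qed
  have LT: "transpose_mat L = L" unfolding L_def by (rule weighted_laplacian_sym) (rule wsym)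
  note spec = eigenvalues_desc_symmetric[OF weighted_laplacian_carrier[of n w, folded L_def] LT, folded es_def]
  have es_bounds: "0 \<le> e" "e \<le> 2 * T" if "e \<in> set es" for e
    using weighted_laplacian_eigenvalue_bounds[of n w T e] w0 T_ge that spec(3) by (auto simp: L_def)
  \<comment> \<open>0 is an eigenvalue and none is negative, so the last entry of the descending
    list is 0.\<close>
  have es_last: "es ! Suc m = 0"
  proof -
    have "0 \<in> set es" using weighted_laplacian_eigenvalue_0[of n w] n3 spec(3) by (simp add: L_def)
    then obtain i where i: "i < n" "es ! i = 0" using spec(1) by (auto simp: in_set_conv_nth)
    have "es ! Suc m \<le> es ! i"
      using sorted_wrt_nth_less[OF spec(2), of i "Suc m"] i spec(1) m by (cases "i = Suc m") auto
    moreover have "es ! Suc m \<ge> 0" using es_bounds(1)[of "es ! Suc m"] spec(1) m by simp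
    ultimately show ?thesis using i by simp
  qed
  \<comment> \<open>The sum of the eigenvalues is the trace, that is, the sum of all
    transmissions.\<close>
  have es_sum: "sum_list es = 2 * W"
    unfolding spec(4) W_def wiener_index_def sumG w_def[symmetric]
    by (simp add: L_def weighted_laplacian_index wii)
  note spread = spread_bounds_sum_list[OF spec(1)[unfolded m(1)] spec(2) es_last, unfolded es_sum]
  have es0_le: "es ! 0 \<le> 2 * T" using es_bounds(2)[of "es ! 0"] spec(1) n3 by simp
  have es0_ge: "real n * T \<le> (real n - 1) * es ! 0"
  proof -
    have "(real n)\<^sup>2 * T \<le> es ! 0 * (real n * (real n - 1))"
      using spec(5)[of "vec n (\<lambda>i. if i = v then real n - 1 else -1)"] n3
        weighted_laplacian_rayleigh[of n w v, OF wsym v(1) wii[OF v(1)]] v(2)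
      by (simp add: L_def)
    hence "real n * (real n * T) \<le> real n * ((real n - 1) * es ! 0)"
      by (simp add: power2_eq_square mult_ac)
    thus ?thesis using n3 by simp
  qed
  \<comment> \<open>This quantitative form serves twice: its right side is nonnegative, giving the
    bound T + 1, and it must vanish when that bound is attained.\<close>
  have es0_gap: "(real n - 1) * (es ! 0 - (T + 1)) \<ge> T - (real n - 1)"
    using es0_ge by (simp add: algebra_simps)
  have es0_T1: "T + 1 \<le> es ! 0"
  proof -
    have "0 \<le> (real n - 1) * (es ! 0 - (T + 1))" using es0_gap T_ge_n by linarith
    thus ?thesis using n3 by (simp add: zero_le_mult_iff)
  qed
  have DLS: "distance_laplacian_spread G vs = es ! 0 - es ! m"
    unfolding distance_laplacian_spread_def L Let_def es_def[symmetric] len m(1) by simp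
  have n_m: "real n = real m + 2" using m by simp
  have m0: "real m > 0" using m by simp
  have lower_es0: "(real n - 1) * es ! 0 - 2 * W \<le> real m * (es ! 0 - es ! m)"
    using spread(1) by (simp add: n_m algebra_simps)
  have mono: "(real n - 1) * (T + 1) \<le> (real n - 1) * es ! 0"
    using es0_T1 n3 by (intro mult_left_mono) auto
  have lower: "((real n - 1) * (T + 1) - 2 * W) / (real n - 2) \<le> es ! 0 - es ! m"
  proof -
    have "(real n - 1) * (T + 1) - 2 * W \<le> (es ! 0 - es ! m) * (real n - 2)"
      using order_trans[OF diff_right_mono[OF mono] lower_es0] by (simp add: n_m mult.commute)
    thus ?thesis using m0 n_m by (simp add: pos_divide_le_eq)
  qed
  have upper: "es ! 0 - es ! m \<le> 2 * (real n - 1) * T - 2 * W"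
  proof -
    have "es ! 0 - es ! m \<le> (real n - 1) * es ! 0 - 2 * W"
      using spread(2) by (simp add: n_m algebra_simps)
    also have "(real n - 1) * es ! 0 \<le> (real n - 1) * (2 * T)"
      using es0_le n3 by (intro mult_left_mono) auto
    finally show ?thesis by (simp add: mult_ac)
  qed
  have eq: "((real n - 1) * (T + 1) - 2 * W) / (real n - 2) = es ! 0 - es ! m \<longleftrightarrow> complete_digraph n G"
  proof
    assume "((real n - 1) * (T + 1) - 2 * W) / (real n - 2) = es ! 0 - es ! m"
    hence "(real n - 1) * (T + 1) - 2 * W = real m * (es ! 0 - es ! m)"
      using m0 by (simp add: n_m field_simps)
    \<comment> \<open>Equality in the final bound collapses the chain through the largest
      eigenvalue, which must therefore equal T + 1.\<close>
    with lower_es0 have "(real n - 1) * es ! 0 \<le> (real n - 1) * (T + 1)" by linarith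
    hence "es ! 0 \<le> T + 1" using n3 by simp
    with es0_T1 have "es ! 0 = T + 1" by simp
    with es0_gap T_ge_n have "T = real n - 1" by simp
    thus "complete_digraph n G" by (simp add: T_eq)
  next
    assume compl: "complete_digraph n G"
    hence T: "T = real n - 1" by (simp add: T_eq)
    \<comment> \<open>For the complete graph both sides are 0. On the left, T + 1 = n and 2W = n(n -
      1). On the right, the largest eigenvalue is at most n, and the trace then forces the one at
      position \<open>m\<close> to be at least n.\<close>
    have w_complete: "w i j = (if i = j then 0 else 1)" if "i < n" "j < n" for i j
      using compl wii that unfolding complete_iff by auto
    have "es ! 0 \<in> {e. eigenvalue L e}" using spec(1,3) n3 nth_mem[of 0 es] by simp
    hence "es ! 0 \<le> real n"
      using complete_laplacian_eigenvalue_le[of n w, OF w_complete] by (simp add: L_def)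
    have row: "(\<Sum>j<n. w i j) = real n - 1" if "i < n" for i
    proof -
      have "(\<Sum>j\<in>{..<n} - {i}. w i j - 1) = 0" using w_complete that by (intro sum.neutral) auto
      with deficit[OF that] show ?thesis by simp
    qed
    have W2: "2 * W = real n * (real n - 1)"
      unfolding W_def wiener_index_def sumG w_def[symmetric] by (simp add: row)
    have "real m * es ! 0 \<le> real m * real n" using \<open>es ! 0 \<le> real n\<close> m0 by simp
    with spread(2) W2 have "es ! m \<ge> real n" by (simp add: n_m algebra_simps)
    moreover have "es ! m \<le> es ! 0"
      using sorted_wrt_nth_less[OF spec(2), of 0 m] spec(1) m by simp
    ultimately have "es ! 0 - es ! m = 0" using \<open>es ! 0 \<le> real n\<close> by simp
    thus "((real n - 1) * (T + 1) - 2 * W) / (real n - 2) = es ! 0 - es ! m"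
      by (simp add: T W2)
  qed
  from lower upper eq show ?thesis unfolding DLS T_def W_def by blast
qed

end
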